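(* The triple $(\mathbf B, \eta, \mu)$ is a left KZ-monad (Kock-Zöberlein monad) on the category of standard quasi-metric spaces and $1$-Lipschitz continuous maps.
   Context: A quasi-metric on $X$ is a map $d \colon X \times X \to [0,+\infty]$ with $d(x,x)=0$, the triangle inequality, and $d(x,y)=d(y,x)=0 \Rightarrow x=y$. Formal balls are pairs $(x,r)$, $x\in X$, $r\in \mathbb{R}_+=[0,+\infty)$, ordered by $(x,r) \leq^{d^+} (y,s)$ iff $d(x,y) \leq r-s$; they form the poset $\mathbf{B}(X,d)$. $X,d$ is standard iff for every directed family $(x_i,r_i)_{i\in I}$ of formal balls and every $s\in\mathbb{R}_+$, $(x_i,r_i)_{i\in I}$ has a supremum in $\mathbf{B}(X,d)$ iff $(x_i,r_i+s)_{i\in I}$ has one. A map $f \colon X,d \to Y,\partial$ is $1$-Lipschitz continuous iff $\mathbf{B}^1(f)\colon (x,r) \mapsto (f(x), r)$ is Scott-continuous (monotonic and preserving existing directed suprema) from $\mathbf{B}(X,d)$ to $\mathbf{B}(Y,\partial)$. $\mathbf{B}(X,d)$ is itself given the quasi-metric $d^+((x,r),(y,s)) = \max(d(x,y)-r+s,0)$. The functor $\mathbf{B}$ maps $X,d$ to $\mathbf{B}(X,d),d^+$ and $f$ to $\mathbf{B}^1(f)$; the unit is $\eta_X \colon x \mapsto (x,0)$ and the multiplication is $\mu_X \colon ((x,r),s) \mapsto (x,r+s)$ from $\mathbf{B}(\mathbf{B}(X,d),d^+)$ to $\mathbf{B}(X,d)$. The category is poset-enriched by: for $f,g \colon X,d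 \to Y,\partial$, $f \leq g$ iff $\partial(f(x),g(x))=0$ for every $x \in X$. A left KZ-monad on a poset-enriched category is a monad $(T,\eta,\mu)$ such that $T$ is monotonic on homsets and one (equivalently, all) of the following equivalent conditions holds: (1) $T\eta_X \leq \eta_{TX}$ for every object $X$; (2) a morphism $\alpha\colon TX \to X$ is the structure map of a $T$-algebra iff $\alpha\circ\eta_X = \mathrm{id}_X$ and $\mathrm{id}_{TX} \leq \eta_X \circ \alpha$; (3) $\mu_X \dashv \eta_{TX}$ for every $X$; (4) $T\eta_X \dashv \mu_X$ for every $X$. Here $f \dashv g$ means $f \circ g \leq \mathrm{id}$ and $\mathrm{id} \leq g \circ f$. *)

theory Defs
  imports "HOL-Library.Extended_Real" "HOL-Library.FuncSet"
begin

section \<open>Order theory on a carrier\<close>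

definition directed_in :: "'a set \<Rightarrow> ('a \<Rightarrow> 'a \<Rightarrow> bool) \<Rightarrow> 'a set \<Rightarrow> bool" where
  "directed_in A le D \<longleftrightarrow>
     D \<subseteq> A \<and> D \<noteq> {} \<and> (\<forall>x\<in>D. \<forall>y\<in>D. \<exists>z\<in>D. le x z \<and> le y z)"

definition is_sup_in :: "'a set \<Rightarrow> ('a \<Rightarrow> 'a \<Rightarrow> bool) \<Rightarrow> 'a set \<Rightarrow> 'a \<Rightarrow> bool" where
  "is_sup_in A le D b \<longleftrightarrow>
     b \<in> A \<and> (\<forall>x\<in>D. le x b) \<and> (\<forall>c\<in>A. (\<forall>x\<in>D. le x c) \<longrightarrow> le b c)"

definition scott_continuous ::
  "'a set \<Rightarrow> ('a \<Rightarrow> 'a \<Rightarrow> bool) \<Rightarrow> 'b set \<Rightarrow> ('b \<Rightarrow> 'b \<Rightarrow> bool) \<Rightarrow> ('a \<Rightarrow> 'b) \<Rightarrow> bool" where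
  "scott_continuous A leA B leB f \<longleftrightarrow>
     f \<in> A \<rightarrow> B \<and>
     (\<forall>x\<in>A. \<forall>y\<in>A. leA x y \<longrightarrow> leB (f x) (f y)) \<and>
     (\<forall>D b. directed_in A leA D \<and> is_sup_in A leA D b \<longrightarrow> is_sup_in B leB (f ` D) (f b))"

section \<open>Quasi-metric spaces and formal balls\<close>

record 'a qspace =
  points :: "'a set"
  qdist :: "'a \<Rightarrow> 'a \<Rightarrow> ereal"

definition quasi_metric_space :: "'a qspace \<Rightarrow> bool" where
  "quasi_metric_space X \<longleftrightarrow>
     (\<forall>x\<in>points X. \<forall>y\<in>points X. 0 \<le> qdist X x y) \<and>
     (\<forall>x\<in>points X. qdist X x x = 0) \<and>
     (\<forall>x\<in>points X. \<forall>y\<in>points X. \<forall>z\<in>points X. qdist X x z \<le> qdist X x y + qdist X y z) \<and>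
     (\<forall>x\<in>points X. \<forall>y\<in>points X. qdist X x y = 0 \<and> qdist X y x = 0 \<longrightarrow> x = y)"

definition balls :: "'a qspace \<Rightarrow> ('a \<times> real) set" where
  "balls X = points X \<times> {0..}"

definition ball_le :: "'a qspace \<Rightarrow> 'a \<times> real \<Rightarrow> 'a \<times> real \<Rightarrow> bool" where
  "ball_le X = (\<lambda>(x, r) (y, s). qdist X x y \<le> ereal (r - s))"

definition ball_dist :: "'a qspace \<Rightarrow> 'a \<times> real \<Rightarrow> 'a \<times> real \<Rightarrow> ereal" where
  "ball_dist X = (\<lambda>(x, r) (y, s). max (qdist X x y - ereal r + ereal s) 0)"

text \<open>Directed families of formal balls are represented by their ranges; neither directedness
  nor suprema depend on the indexing.\<close>

definition standard :: "'a qspace \<Rightarrow> bool" where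
  "standard X \<longleftrightarrow>
     (\<forall>D s. directed_in (balls X) (ball_le X) D \<and> 0 \<le> s \<longrightarrow>
        (\<exists>b. is_sup_in (balls X) (ball_le X) D b) \<longleftrightarrow>
        (\<exists>b. is_sup_in (balls X) (ball_le X) ((\<lambda>(x, r). (x, r + s)) ` D) b))"

definition standard_qms :: "'a qspace \<Rightarrow> bool" where
  "standard_qms X \<longleftrightarrow> quasi_metric_space X \<and> standard X"

definition ball_map :: "('a \<Rightarrow> 'b) \<Rightarrow> 'a \<times> real \<Rightarrow> 'b \<times> real" where
  "ball_map f = (\<lambda>(x, r). (f x, r))"

definition lipschitz1_continuous :: "'a qspace \<Rightarrow> 'b qspace \<Rightarrow> ('a \<Rightarrow> 'b) \<Rightarrow> bool" where
  "lipschitz1_continuous X Y f \<longleftrightarrow>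
     f \<in> points X \<rightarrow> points Y \<and>
     scott_continuous (balls X) (ball_le X) (balls Y) (ball_le Y) (ball_map f)"

section \<open>Poset-enriched categories and left KZ-monads\<close>

record ('o, 'm) pcat =
  Obj :: "'o set"
  Arr :: "'m set"
  Dom :: "'m \<Rightarrow> 'o"
  Cod :: "'m \<Rightarrow> 'o"
  Ide :: "'o \<Rightarrow> 'm"
  Comp :: "'m \<Rightarrow> 'm \<Rightarrow> 'm"  (infixr "\<cdot>\<index>" 70)
  Leq :: "'m \<Rightarrow> 'm \<Rightarrow> bool"  (infix "\<sqsubseteq>\<index>" 50)

definition hom :: "('o, 'm, 'z) pcat_scheme \<Rightarrow> 'o \<Rightarrow> 'o \<Rightarrow> 'm set" where
  "hom C X Y = {f \<in> Arr C. Dom C f = X \<and> Cod C f = Y}"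

locale category =
  fixes C :: "('o, 'm, 'z) pcat_scheme" (structure)
  assumes Dom_in: "f \<in> Arr C \<Longrightarrow> Dom C f \<in> Obj C"
    and Cod_in: "f \<in> Arr C \<Longrightarrow> Cod C f \<in> Obj C"
    and Ide_in: "X \<in> Obj C \<Longrightarrow> Ide C X \<in> hom C X X"
    and Comp_in: "f \<in> hom C X Y \<Longrightarrow> g \<in> hom C Y Z \<Longrightarrow> g \<cdot> f \<in> hom C X Z"
    and Comp_Ide: "f \<in> hom C X Y \<Longrightarrow> f \<cdot> Ide C X = f"
    and Ide_Comp: "f \<in> hom C X Y \<Longrightarrow> Ide C Y \<cdot> f = f"
    and Comp_assoc: "f \<in> hom C W X \<Longrightarrow> g \<in> hom C X Y \<Longrightarrow> h \<in> hom C Y Z \<Longrightarrow>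
        (h \<cdot> g) \<cdot> f = h \<cdot> (g \<cdot> f)"

locale poset_enriched_category = category +
  assumes Leq_refl: "f \<in> hom C X Y \<Longrightarrow> f \<sqsubseteq> f"
    and Leq_trans: "f \<in> hom C X Y \<Longrightarrow> g \<in> hom C X Y \<Longrightarrow> h \<in> hom C X Y \<Longrightarrow>
        f \<sqsubseteq> g \<Longrightarrow> g \<sqsubseteq> h \<Longrightarrow> f \<sqsubseteq> h"
    and Leq_antisym: "f \<in> hom C X Y \<Longrightarrow> g \<in> hom C X Y \<Longrightarrow> f \<sqsubseteq> g \<Longrightarrow> g \<sqsubseteq> f \<Longrightarrow> f = g"
    and Comp_mono: "f \<in> hom C X Y \<Longrightarrow> f' \<in> hom C X Y \<Longrightarrow> g \<in> hom C Y Z \<Longrightarrow> g' \<in> hom C Y Z \<Longrightarrow>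
        f \<sqsubseteq> f' \<Longrightarrow> g \<sqsubseteq> g' \<Longrightarrow> g \<cdot> f \<sqsubseteq> g' \<cdot> f'"

text \<open>An endofunctor is given by its action \<open>T\<close> on objects and \<open>F\<close> on arrows.\<close>

locale endofunctor = category +
  fixes T :: "'a \<Rightarrow> 'a" and F :: "'b \<Rightarrow> 'b"
  assumes T_in: "X \<in> Obj C \<Longrightarrow> T X \<in> Obj C"
    and F_in: "f \<in> hom C X Y \<Longrightarrow> F f \<in> hom C (T X) (T Y)"
    and F_Ide: "X \<in> Obj C \<Longrightarrow> F (Ide C X) = Ide C (T X)"
    and F_Comp: "f \<in> hom C X Y \<Longrightarrow> g \<in> hom C Y Z \<Longrightarrow> F (g \<cdot> f) = F g \<cdot> F f"

locale monad = endofunctor +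
  fixes \<eta> :: "'a \<Rightarrow> 'b" and \<mu> :: "'a \<Rightarrow> 'b"
  assumes unit_in: "X \<in> Obj C \<Longrightarrow> \<eta> X \<in> hom C X (T X)"
    and mult_in: "X \<in> Obj C \<Longrightarrow> \<mu> X \<in> hom C (T (T X)) (T X)"
    and unit_natural: "f \<in> hom C X Y \<Longrightarrow> F f \<cdot> \<eta> X = \<eta> Y \<cdot> f"
    and mult_natural: "f \<in> hom C X Y \<Longrightarrow> F f \<cdot> \<mu> X = \<mu> Y \<cdot> F (F f)"
    and mult_assoc: "X \<in> Obj C \<Longrightarrow> \<mu> X \<cdot> F (\<mu> X) = \<mu> X \<cdot> \<mu> (T X)"
    and mult_unit_left: "X \<in> Obj C \<Longrightarrow> \<mu> X \<cdot> \<eta> (T X) = Ide C (T X)"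
    and mult_unit_right: "X \<in> Obj C \<Longrightarrow> \<mu> X \<cdot> F (\<eta> X) = Ide C (T X)"
begin

definition is_algebra :: "'a \<Rightarrow> 'b \<Rightarrow> bool" where
  "is_algebra X \<alpha> \<longleftrightarrow>
     \<alpha> \<in> hom C (T X) X \<and> \<alpha> \<cdot> \<eta> X = Ide C X \<and> \<alpha> \<cdot> F \<alpha> = \<alpha> \<cdot> \<mu> X"

end

definition adjoint :: "('o, 'm, 'z) pcat_scheme \<Rightarrow> 'o \<Rightarrow> 'o \<Rightarrow> 'm \<Rightarrow> 'm \<Rightarrow> bool" where
  "adjoint C X Y f g \<longleftrightarrow>
     f \<in> hom C X Y \<and> g \<in> hom C Y X \<and>
     Leq C (Comp C f g) (Ide C Y) \<and> Leq C (Ide C X) (Comp C g f)"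

text \<open>The conditions \<open>KZ1\<close> to \<open>KZ4\<close> are equivalent given the other requirements; all four are
  demanded, so that no choice of a representative is involved.\<close>

locale left_KZ_monad = monad + poset_enriched_category +
  assumes F_mono: "f \<in> hom C X Y \<Longrightarrow> g \<in> hom C X Y \<Longrightarrow> f \<sqsubseteq> g \<Longrightarrow> F f \<sqsubseteq> F g"
    and KZ1: "X \<in> Obj C \<Longrightarrow> F (\<eta> X) \<sqsubseteq> \<eta> (T X)"
    and KZ2: "X \<in> Obj C \<Longrightarrow> \<alpha> \<in> hom C (T X) X \<Longrightarrow>
        is_algebra X \<alpha> \<longleftrightarrow> \<alpha> \<cdot> \<eta> X = Ide C X \<and> Ide C (T X) \<sqsubseteq> \<eta> X \<cdot> \<alpha>"
    and KZ3: "X \<in> Obj C \<Longrightarrow> adjoint C (T (T X)) (T X) (\<mu> X) (\<eta> (T X))"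
    and KZ4: "X \<in> Obj C \<Longrightarrow> adjoint C (T X) (T (T X)) (F (\<eta> X)) (\<mu> X)"

section \<open>The category of standard quasi-metric spaces\<close>

text \<open>Maps are made extensional on their domain, so that equality of arrows is equality of maps.\<close>

datatype 'a qarrow = QArrow (source: "'a qspace") (fn: "'a \<Rightarrow> 'a") (target: "'a qspace")

definition mk_arrow :: "'a qspace \<Rightarrow> ('a \<Rightarrow> 'a) \<Rightarrow> 'a qspace \<Rightarrow> 'a qarrow" where
  "mk_arrow X f Y = QArrow X (restrict f (points X)) Y"

definition SQMet :: "('a qspace, 'a qarrow) pcat" where
  "SQMet = \<lparr>
     Obj = {X. standard_qms X},
     Arr = {f. standard_qms (source f) \<and> standard_qms (target f) \<and>
               fn f \<in> extensional (points (source f)) \<and>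
               lipschitz1_continuous (source f) (target f) (fn f)},
     Dom = source,
     Cod = target,
     Ide = (\<lambda>X. mk_arrow X (\<lambda>x. x) X),
     Comp = (\<lambda>g f. mk_arrow (source f) (fn g \<circ> fn f) (target g)),
     Leq = (\<lambda>f g. source f = source g \<and> target f = target g \<and>
               (\<forall>x\<in>points (source f). qdist (target f) (fn f x) (fn g x) = 0))\<rparr>"

section \<open>The formal ball monad\<close>

text \<open>The formal balls of a space over \<open>'a\<close> form a space over \<open>'a \<times> real\<close>.  To have an
  endofunctor on one category, spaces are taken over a type that contains an arbitrary type
  \<open>'a\<close> of points and, through the injective constructor \<open>FBall\<close>, all pairs of one of its
  elements and a real number.  Every space over \<open>'a\<close> is isometric, along \<open>Point\<close>, to one over
  \<open>'a universe\<close>.\<close>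

datatype 'a universe = Point 'a | FBall (unFBall: "'a universe \<times> real")

definition B_obj :: "'a universe qspace \<Rightarrow> 'a universe qspace" where
  "B_obj X = \<lparr>points = FBall ` balls X, qdist = (\<lambda>p q. ball_dist X (unFBall p) (unFBall q))\<rparr>"

definition B_arr :: "'a universe qarrow \<Rightarrow> 'a universe qarrow" where
  "B_arr f =
     mk_arrow (B_obj (source f)) (\<lambda>p. FBall (ball_map (fn f) (unFBall p))) (B_obj (target f))"

definition B_unit :: "'a universe qspace \<Rightarrow> 'a universe qarrow" where
  "B_unit X = mk_arrow X (\<lambda>x. FBall (x, 0)) (B_obj X)"

definition B_mult :: "'a universe qspace \<Rightarrow> 'a universe qarrow" where
  "B_mult X =
     mk_arrow (B_obj (B_obj X))
       (\<lambda>p. case unFBall p of (b, s) \<Rightarrow> case unFBall b of (x, r) \<Rightarrow> FBall (x, r + s))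
       (B_obj X)"

end

theory Submission
  imports Defs
begin

text \<open>
  Write \<open>\<beta>\<close> for the map \<open>((x, r), s) \<mapsto> (x, r + s)\<close>.  In \<open>\<^bold>B(\<^bold>B X)\<close> one has \<open>p \<le> q\<close> iff
  \<open>\<beta> p \<le> \<beta> q\<close> and the outer radius of \<open>q\<close> is at most that of \<open>p\<close>.  In a standard space the
  radius of a directed supremum is the infimum of the radii, so \<open>b\<close> is the supremum of a directed
  family \<open>D\<close> in \<open>\<^bold>B(\<^bold>B X)\<close> iff \<open>\<beta> b\<close> is the supremum of \<open>\<beta> D\<close> and the outer radius of \<open>b\<close> is the
  infimum of the outer radii.  This gives standardness of \<open>\<^bold>B X\<close> and reduces the continuity of a
  map \<open>f\<close> into \<open>\<^bold>B Y\<close> to the Scott continuity of \<open>\<beta> \<circ> \<^bold>B\<^sup>1(f)\<close>.  The Kock-Zoeberlein conditions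
  are formal consequences of \<open>T \<eta> \<le> \<eta> T\<close>; the second one uses that two left adjoints of
  the same arrow coincide.
\<close>

section \<open>Scott continuity\<close>

lemma directed_in_image:
  assumes "directed_in A leA D" and "f \<in> A \<rightarrow> B"
    and "\<And>x y. x \<in> A \<Longrightarrow> y \<in> A \<Longrightarrow> leA x y \<Longrightarrow> leB (f x) (f y)"
  shows "directed_in B leB (f ` D)"
proof -
  have "\<exists>z\<in>f ` D. leB x z \<and> leB y z" if "x \<in> f ` D" "y \<in> f ` D" for x y
  proof -
    from that obtain u v where uv: "u \<in> D" "v \<in> D" "x = f u" "y = f v" by blast
    with assms(1) obtain w where "w \<in> D" "leA u w" "leA v w"
      unfolding directed_in_def by blast
    with uv assms show ?thesis unfolding directed_in_def by blast
  qed
  with assms(1,2) show ?thesis unfolding directed_in_def by blast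
qed

lemma scott_continuous_id: "scott_continuous A le A le id"
  by (auto simp: scott_continuous_def)

lemma scott_continuous_comp:
  assumes f: "scott_continuous A leA B leB f" and g: "scott_continuous B leB C leC g"
  shows "scott_continuous A leA C leC (g \<circ> f)"
  unfolding scott_continuous_def
proof (intro conjI allI impI ballI)
  show "g \<circ> f \<in> A \<rightarrow> C" using f g by (auto simp: scott_continuous_def Pi_iff)
next
  fix x y assume "x \<in> A" "y \<in> A" "leA x y"
  with f g show "leC ((g \<circ> f) x) ((g \<circ> f) y)" by (auto simp: scott_continuous_def Pi_iff)
next
  fix D b assume Db: "directed_in A leA D \<and> is_sup_in A leA D b"
  then have "directed_in B leB (f ` D)" "is_sup_in B leB (f ` D) (f b)"
    using f by (auto simp: scott_continuous_def intro: directed_in_image)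
  with g have "is_sup_in C leC (g ` f ` D) (g (f b))"
    unfolding scott_continuous_def by blast
  then show "is_sup_in C leC ((g \<circ> f) ` D) ((g \<circ> f) b)" by (simp add: image_comp)
qed

lemma scott_continuous_cong:
  assumes eq: "\<And>x. x \<in> A \<Longrightarrow> f x = g x" and f: "scott_continuous A leA B leB f"
  shows "scott_continuous A leA B leB g"
  unfolding scott_continuous_def
proof (intro conjI allI impI ballI)
  show "g \<in> A \<rightarrow> B" using f eq by (auto simp: scott_continuous_def Pi_iff)
next
  fix x y assume "x \<in> A" "y \<in> A" "leA x y"
  then have "leB (f x) (f y)" using f unfolding scott_continuous_def by blast
  with \<open>x \<in> A\<close> \<open>y \<in> A\<close> show "leB (g x) (g y)" by (simp add: eq)
next
  fix D b assume Db: "directed_in A leA D \<and> is_sup_in A leA D b"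
  then have "f ` D = g ` D" "f b = g b"
    using eq by (auto simp: directed_in_def is_sup_in_def intro!: image_cong)
  with f Db show "is_sup_in B leB (g ` D) (g b)"
    by (metis scott_continuous_def)
qed

section \<open>Directed suprema of formal balls\<close>

abbreviation ball_directed :: "'a qspace \<Rightarrow> ('a \<times> real) set \<Rightarrow> bool" where
  "ball_directed X \<equiv> directed_in (balls X) (ball_le X)"

abbreviation ball_sup :: "'a qspace \<Rightarrow> ('a \<times> real) set \<Rightarrow> 'a \<times> real \<Rightarrow> bool" where
  "ball_sup X \<equiv> is_sup_in (balls X) (ball_le X)"

abbreviation ball_continuous ::
  "'a qspace \<Rightarrow> 'b qspace \<Rightarrow> ('a \<times> real \<Rightarrow> 'b \<times> real) \<Rightarrow> bool" where
  "ball_continuous X Y \<equiv> scott_continuous (balls X) (ball_le X) (balls Y) (ball_le Y)"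

text \<open>Names the shift that occurs inside \<open>standard\<close>. The argument may be
  negative; \<open>ball_sup_radius\<close> shifts down so that the infimum of the radii becomes
  0.\<close>

definition ball_shift :: "real \<Rightarrow> 'a \<times> real \<Rightarrow> 'a \<times> real" where
  "ball_shift s = (\<lambda>(x, r). (x, r + s))"

lemma ball_shift_simps [simp]:
  "fst (ball_shift s p) = fst p" "snd (ball_shift s p) = snd p + s"
  "ball_shift s (ball_shift t p) = ball_shift (t + s) p" "ball_shift 0 p = p"
  by (auto simp: ball_shift_def split_beta)

lemma ball_le_iff: "ball_le X p q \<longleftrightarrow> qdist X (fst p) (fst q) \<le> ereal (snd p - snd q)"
  by (simp add: ball_le_def split_beta)

lemma balls_iff: "p \<in> balls X \<longleftrightarrow> fst p \<in> points X \<and> 0 \<le> snd p"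
  by (auto simp: balls_def mem_Times_iff)

lemma ball_le_shift [simp]: "ball_le X (ball_shift s p) (ball_shift s q) \<longleftrightarrow> ball_le X p q"
  by (simp add: ball_le_iff)

text \<open>Nonnegativity of the distance between the centers forces the difference of the radii to
  be nonnegative.\<close>

lemma ball_le_radius:
  assumes "quasi_metric_space X" "p \<in> balls X" "q \<in> balls X" "ball_le X p q"
  shows "snd q \<le> snd p"
proof -
  have "0 \<le> qdist X (fst p) (fst q)"
    using assms by (auto simp: quasi_metric_space_def balls_iff)
  with assms(4) have "ereal 0 \<le> ereal (snd p - snd q)"
    by (simp add: ball_le_iff) (metis order_trans zero_ereal_def ereal_less_eq(3) diff_ge_0_iff_ge)
  then show ?thesis by simp
qed

lemma standard_iff_shift:
  "standard X \<longleftrightarrow>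
     (\<forall>D s. ball_directed X D \<and> 0 \<le> s \<longrightarrow>
        (\<exists>b. ball_sup X D b) \<longleftrightarrow> (\<exists>b. ball_sup X (ball_shift s ` D) b))"
  by (simp add: standard_def ball_shift_def)

lemma Inf_radius_le:
  assumes "D \<subseteq> balls X" "p \<in> D"
  shows "Inf (snd ` D) \<le> snd p"
proof (rule cInf_lower)
  show "bdd_below (snd ` D)" using assms by (intro bdd_belowI2[of _ 0]) (auto simp: balls_iff)
qed (use assms in simp)

lemma Inf_radius_greatest:
  fixes D :: "('a \<times> real) set"
  assumes "D \<noteq> {}" "\<And>p. p \<in> D \<Longrightarrow> t \<le> snd p"
  shows "t \<le> Inf (snd ` D)"
  using assms by (intro cInf_greatest) auto

text \<open>Shifting the family by the infimum of the radii yields a family whose supremum has radius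
  zero; shifted back, it bounds the radius of the supremum from below.\<close>

lemma ball_sup_radius:
  assumes X: "standard_qms X" and D: "ball_directed X D" and b: "ball_sup X D b"
  shows "snd b = Inf (snd ` D)"
proof (rule antisym)
  have qm: "quasi_metric_space X" and st: "standard X"
    using X by (auto simp: standard_qms_def)
  have DX: "D \<subseteq> balls X" and ne: "D \<noteq> {}" using D by (auto simp: directed_in_def)
  have bX: "b \<in> balls X" using b by (simp add: is_sup_in_def)
  show "snd b \<le> Inf (snd ` D)"
  proof (rule Inf_radius_greatest[OF ne])
    fix p assume "p \<in> D"
    then show "snd b \<le> snd p"
      using b DX bX by (intro ball_le_radius[OF qm]) (auto simp: is_sup_in_def)
  qed
  define m where "m = Inf (snd ` D)"
  have m0: "0 \<le> m" unfolding m_def using ne DX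
    by (intro Inf_radius_greatest) (auto simp: balls_iff)
  define E where "E = ball_shift (- m) ` D"
  \<comment> \<open>Subtracting \<open>m\<close> keeps the radii nonnegative because
    \<open>m\<close> is a lower bound of them.\<close>
  have EX: "E \<subseteq> balls X"
    using DX Inf_radius_le[OF DX] by (auto simp: E_def balls_iff m_def)
  have "ball_directed X E"
    using D EX by (auto simp: directed_in_def E_def)
  moreover have ED: "ball_shift m ` E = D" by (simp add: E_def image_image)
  \<comment> \<open>Standardness is read from the shifted family back to the unshifted one:
    \<open>E\<close> shifted by \<open>m\<close> is \<open>D\<close>, which has the supremum
    \<open>b\<close>.\<close>
  ultimately obtain c where c: "ball_sup X E c"
    using st b m0 unfolding standard_iff_shift by metis
  have cX: "c \<in> balls X" using c by (simp add: is_sup_in_def)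
  have "snd c + m \<le> Inf (snd ` D)"
  proof (rule Inf_radius_greatest[OF ne])
    fix p assume p: "p \<in> D"
    then have "ball_shift (- m) p \<in> E" by (simp add: E_def)
    then have "snd c \<le> snd (ball_shift (- m) p)"
      using c cX EX by (intro ball_le_radius[OF qm]) (auto simp: is_sup_in_def)
    then show "snd c + m \<le> snd p" by simp
  qed
  \<comment> \<open>The bound just shown reads \<open>snd c + m \<le> m\<close>, and radii are
    nonnegative.\<close>
  then have c0: "snd c = 0" using cX by (simp add: m_def balls_iff)
  have "ball_shift m c \<in> balls X" using cX m0 by (simp add: balls_iff)
  moreover have "\<forall>p\<in>D. ball_le X p (ball_shift m c)"
    using c by (auto simp: is_sup_in_def ED[symmetric])
  ultimately have "ball_le X b (ball_shift m c)" using b by (auto simp: is_sup_in_def)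
  then have "snd (ball_shift m c) \<le> snd b"
    using bX \<open>ball_shift m c \<in> balls X\<close> by (intro ball_le_radius[OF qm])
  then show "Inf (snd ` D) \<le> snd b" by (simp add: c0 m_def)
qed

section \<open>The space of formal balls\<close>

text \<open>The map \<open>\<beta>\<close> of the overview: the multiplication with the outer
  \<open>FBall\<close> stripped from argument and result, so that it acts on formal balls rather
  than on points.\<close>

definition flatten :: "'a universe \<times> real \<Rightarrow> 'a universe \<times> real" where
  "flatten p = (fst (unFBall (fst p)), snd (unFBall (fst p)) + snd p)"

lemma points_B_obj: "points (B_obj X) = FBall ` balls X"
  and qdist_B_obj: "qdist (B_obj X) p q = ball_dist X (unFBall p) (unFBall q)"
  by (simp_all add: B_obj_def)

text \<open>The truncation at 0 in \<open>ball_dist\<close> produces the conjunct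
  \<open>0 \<le> t\<close>. Taking a difference of outer radii for \<open>t\<close> yields
  \<open>ball_le_B_obj\<close>.\<close>

lemma ball_dist_le_iff:
  "ball_dist X p q \<le> ereal t \<longleftrightarrow>
     qdist X (fst p) (fst q) \<le> ereal (snd p - snd q + t) \<and> 0 \<le> t"
  by (cases "qdist X (fst p) (fst q)") (auto simp: ball_dist_def split_beta)

text \<open>Through this, the order on hom-sets, defined by distance zero, becomes the ball order
  when the target is \<open>B_obj X\<close>.\<close>

lemma ball_dist_eq_0_iff: "ball_dist X p q = 0 \<longleftrightarrow> ball_le X p q"
  using ball_dist_le_iff[of X p q 0]
  by (auto simp: ball_le_iff ball_dist_def split_beta zero_ereal_def[symmetric] max_def)

lemma ball_le_B_obj:
  "ball_le (B_obj X) p q \<longleftrightarrow> ball_le X (flatten p) (flatten q) \<and> snd q \<le> snd p"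
  by (simp add: ball_le_iff qdist_B_obj ball_dist_le_iff flatten_def algebra_simps)

lemma balls_B_obj_iff:
  "p \<in> balls (B_obj X) \<longleftrightarrow> (\<exists>x r s. p = (FBall (x, r), s) \<and> x \<in> points X \<and> 0 \<le> r \<and> 0 \<le> s)"
  by (cases p) (auto simp: balls_def points_B_obj)

lemma FBall_in_points [simp]: "FBall (x, r) \<in> points (B_obj X) \<longleftrightarrow> x \<in> points X \<and> 0 \<le> r"
  by (auto simp: points_B_obj balls_def)

lemma points_B_objE:
  assumes "p \<in> points (B_obj X)"
  obtains x r where "p = FBall (x, r)" "x \<in> points X" "0 \<le> r"
  using assms by (auto simp: points_B_obj balls_def)

lemma flatten_in: "flatten \<in> balls (B_obj X) \<rightarrow> balls X"
proof
  fix p assume "p \<in> balls (B_obj X)"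
  then show "flatten p \<in> balls X"
    unfolding balls_B_obj_iff by (auto simp: flatten_def balls_def)
qed

lemma flatten_FBall [simp]: "flatten (FBall p, s) = (fst p, snd p + s)"
  by (simp add: flatten_def)

section \<open>The order on formal balls and the quasi-metric on \<open>B_obj X\<close>\<close>

lemma ball_le_refl:
  assumes "quasi_metric_space X" "p \<in> balls X"
  shows "ball_le X p p"
  using assms by (auto simp: quasi_metric_space_def balls_iff ball_le_iff)

lemma ball_le_trans:
  assumes "quasi_metric_space X" "p \<in> balls X" "q \<in> balls X" "w \<in> balls X"
    and "ball_le X p q" "ball_le X q w"
  shows "ball_le X p w"
proof -
  have "qdist X (fst p) (fst w) \<le> qdist X (fst p) (fst q) + qdist X (fst q) (fst w)"
    using assms by (auto simp: quasi_metric_space_def balls_iff)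
  also have "\<dots> \<le> ereal (snd p - snd q) + ereal (snd q - snd w)"
    using assms by (intro add_mono) (auto simp: ball_le_iff)
  finally show ?thesis by (simp add: ball_le_iff)
qed

lemma ball_le_antisym:
  assumes qm: "quasi_metric_space X" and pq: "p \<in> balls X" "q \<in> balls X"
    and le: "ball_le X p q" "ball_le X q p"
  shows "p = q"
proof -
  have r: "snd p = snd q" using ball_le_radius[OF qm] pq le by (meson antisym)
  have nn: "0 \<le> qdist X (fst p) (fst q)" "0 \<le> qdist X (fst q) (fst p)"
    using qm pq by (auto simp: quasi_metric_space_def balls_iff)
  have "qdist X (fst p) (fst q) = 0" "qdist X (fst q) (fst p) = 0"
    using le nn r by (auto simp: ball_le_iff zero_ereal_def[symmetric] antisym)
  then have "fst p = fst q" using qm pq by (auto simp: quasi_metric_space_def balls_iff)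
  with r show ?thesis by (simp add: prod_eq_iff)
qed

lemma ball_dist_triangle:
  assumes "quasi_metric_space X" "p \<in> balls X" "q \<in> balls X" "w \<in> balls X"
  shows "ball_dist X p w \<le> ball_dist X p q + ball_dist X q w"
proof -
  have "qdist X (fst p) (fst w) \<le> qdist X (fst p) (fst q) + qdist X (fst q) (fst w)"
    and "0 \<le> qdist X (fst p) (fst w)" "0 \<le> qdist X (fst p) (fst q)" "0 \<le> qdist X (fst q) (fst w)"
    using assms by (auto simp: quasi_metric_space_def balls_iff)
  then show ?thesis
    unfolding ball_dist_def split_beta
    \<comment> \<open>Nonnegativity excludes minus infinity. If the distance from \<open>p\<close>
      to \<open>w\<close> is infinite, so is one of the other two; the finite case is real
      arithmetic.\<close>
    by (cases "qdist X (fst p) (fst w)"; cases "qdist X (fst p) (fst q)";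
        cases "qdist X (fst q) (fst w)") (auto simp: max_def zero_ereal_def)
qed

lemma quasi_metric_space_B_obj:
  assumes qm: "quasi_metric_space X"
  shows "quasi_metric_space (B_obj X)"
  unfolding quasi_metric_space_def
proof (intro conjI ballI impI)
  fix p q assume "p \<in> points (B_obj X)" "q \<in> points (B_obj X)"
  show "0 \<le> qdist (B_obj X) p q" by (simp add: qdist_B_obj ball_dist_def split_beta)
next
  fix p assume "p \<in> points (B_obj X)"
  then show "qdist (B_obj X) p p = 0"
    by (auto simp: qdist_B_obj ball_dist_eq_0_iff points_B_obj intro: ball_le_refl[OF qm])
next
  fix p q w assume "p \<in> points (B_obj X)" "q \<in> points (B_obj X)" "w \<in> points (B_obj X)"
  then show "qdist (B_obj X) p w \<le> qdist (B_obj X) p q + qdist (B_obj X) q w"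
    by (auto simp: qdist_B_obj points_B_obj intro: ball_dist_triangle[OF qm])
next
  fix p q assume "p \<in> points (B_obj X)" "q \<in> points (B_obj X)"
    "qdist (B_obj X) p q = 0 \<and> qdist (B_obj X) q p = 0"
  then show "p = q"
    unfolding qdist_B_obj ball_dist_eq_0_iff points_B_obj
    by (metis ball_le_antisym[OF qm] image_iff universe.sel)
qed

section \<open>Directed suprema in \<open>B_obj X\<close> by flattening, and standardness\<close>

lemma ball_directed_flatten:
  assumes "ball_directed (B_obj X) D"
  shows "ball_directed X (flatten ` D)"
  using assms flatten_in by (rule directed_in_image) (simp add: ball_le_B_obj)

text \<open>An upper bound \<open>c\<close> of the flattened family lifts to an upper bound of
  \<open>D\<close> that flattens to \<open>c\<close>, so leastness of \<open>b\<close> gives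
  leastness of \<open>flatten b\<close>.\<close>

lemma ball_sup_flatten:
  assumes D: "ball_directed (B_obj X) D" and b: "ball_sup (B_obj X) D b"
  shows "ball_sup X (flatten ` D) (flatten b)"
  unfolding is_sup_in_def
proof (intro conjI ballI impI)
  have DX: "D \<subseteq> balls (B_obj X)" and ne: "D \<noteq> {}" using D by (auto simp: directed_in_def)
  show "flatten b \<in> balls X" using b flatten_in by (auto simp: is_sup_in_def)
  show "ball_le X p (flatten b)" if "p \<in> flatten ` D" for p
    using that b by (auto simp: is_sup_in_def ball_le_B_obj)
  fix c assume c: "c \<in> balls X" and ub: "\<forall>p\<in>flatten ` D. ball_le X p c"
  \<comment> \<open>\<open>u\<close> is the outer radius of the lift. Being at most every outer
    radius in \<open>D\<close>, it makes the lift an upper bound; being at most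
    \<open>snd c\<close>, it leaves a nonnegative inner radius.\<close>
  define u where "u = min (snd c) (Inf (snd ` D))"
  define e where "e = (FBall (fst c, snd c - u), u)"
  have "0 \<le> Inf (snd ` D)"
    using ne DX by (intro Inf_radius_greatest) (auto simp: balls_iff)
  then have "e \<in> balls (B_obj X)"
    using c by (auto simp: e_def u_def balls_def)
  moreover have "flatten e = c" by (simp add: e_def)
  moreover have "ball_le (B_obj X) p e" if "p \<in> D" for p
  proof -
    have "u \<le> snd p" using Inf_radius_le[OF DX that] by (simp add: u_def)
    then show ?thesis using ub that \<open>flatten e = c\<close> by (simp add: ball_le_B_obj) (simp add: e_def)
  qed
  ultimately show "ball_le X (flatten b) c"
    using b by (auto simp: is_sup_in_def ball_le_B_obj)
qed

text \<open>\<open>ball_le_B_obj\<close> splits the order into that of the flattened balls and that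
  of the outer radii, so leastness can be checked on the two parts separately.\<close>

lemma ball_sup_B_objI:
  assumes D: "ball_directed (B_obj X) D" and b: "b \<in> balls (B_obj X)"
    and sup: "ball_sup X (flatten ` D) (flatten b)" and r: "snd b = Inf (snd ` D)"
  shows "ball_sup (B_obj X) D b"
proof -
  have DX: "D \<subseteq> balls (B_obj X)" and ne: "D \<noteq> {}" using D by (auto simp: directed_in_def)
  have "snd c \<le> snd b" if "\<forall>p\<in>D. ball_le (B_obj X) p c" for c
    unfolding r using ne that by (intro Inf_radius_greatest) (auto simp: ball_le_B_obj)
  with b sup Inf_radius_le[OF DX] flatten_in[of X] show ?thesis
    unfolding is_sup_in_def ball_le_B_obj by (auto simp: r)
qed

lemma ball_sup_B_obj_iff_flatten:
  assumes X: "standard_qms X" and D: "ball_directed (B_obj X) D"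
  shows "(\<exists>b. ball_sup (B_obj X) D b) \<longleftrightarrow> (\<exists>c. ball_sup X (flatten ` D) c)"
proof
  assume "\<exists>c. ball_sup X (flatten ` D) c"
  then obtain c where c: "ball_sup X (flatten ` D) c" by blast
  have DX: "D \<subseteq> balls (B_obj X)" and ne: "D \<noteq> {}" using D by (auto simp: directed_in_def)
  define m where "m = Inf (snd ` D)"
  have "0 \<le> m" unfolding m_def
    using ne DX by (intro Inf_radius_greatest) (auto simp: balls_iff)
  have "m \<le> snd (flatten p)" if "p \<in> D" for p
  proof -
    have "p \<in> balls (B_obj X)" using that DX by blast
    then have "snd p \<le> snd (flatten p)"
      unfolding balls_B_obj_iff by (auto simp: flatten_def)
    with Inf_radius_le[OF DX that] show ?thesis by (simp add: m_def)
  qed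
  \<comment> \<open>Standardness of \<open>X\<close> enters here: \<open>snd c\<close> is the
    infimum of the flattened radii, which are all at least \<open>m\<close>. Hence
    \<open>snd c - m\<close> can serve as inner radius.\<close>
  then have "m \<le> snd c"
    unfolding ball_sup_radius[OF X ball_directed_flatten[OF D] c]
    using ne by (intro Inf_radius_greatest) auto
  then have "ball_sup (B_obj X) D (FBall (fst c, snd c - m), m)"
    using c \<open>0 \<le> m\<close>
    by (intro ball_sup_B_objI[OF D]) (auto simp: balls_B_obj_iff m_def is_sup_in_def balls_iff)
  then show "\<exists>b. ball_sup (B_obj X) D b" by blast
qed (use ball_sup_flatten[OF D] in blast)

text \<open>Flattening commutes with shifting, so the existence of suprema is transferred to
  \<open>X\<close>, where standardness applies.\<close>

lemma standard_qms_B_obj: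
  assumes X: "standard_qms X"
  shows "standard_qms (B_obj X)"
proof -
  have qm: "quasi_metric_space X" and st: "standard X"
    using X by (auto simp: standard_qms_def)
  have "(\<exists>b. ball_sup (B_obj X) D b) \<longleftrightarrow> (\<exists>b. ball_sup (B_obj X) (ball_shift s ` D) b)"
    if D: "ball_directed (B_obj X) D" and s: "0 \<le> s" for D and s :: real
  proof -
    have D': "ball_directed (B_obj X) (ball_shift s ` D)"
      using D s by (intro directed_in_image[OF D]) (auto simp: balls_iff)
    have "(\<exists>b. ball_sup (B_obj X) (ball_shift s ` D) b) \<longleftrightarrow>
        (\<exists>c. ball_sup X (flatten ` ball_shift s ` D) c)"
      by (rule ball_sup_B_obj_iff_flatten[OF X D'])
    also have "flatten ` ball_shift s ` D = ball_shift s ` flatten ` D"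
      unfolding image_image by (simp add: flatten_def ball_shift_def split_beta add.assoc)
    also have "(\<exists>c. ball_sup X (ball_shift s ` flatten ` D) c) \<longleftrightarrow> (\<exists>c. ball_sup X (flatten ` D) c)"
      using st ball_directed_flatten[OF D] s unfolding standard_iff_shift by metis
    finally show ?thesis using ball_sup_B_obj_iff_flatten[OF X D] by simp
  qed
  then have "standard (B_obj X)" unfolding standard_iff_shift by blast
  with quasi_metric_space_B_obj[OF qm] show ?thesis by (simp add: standard_qms_def)
qed

section \<open>Lipschitz continuous maps\<close>

lemma ball_map_simps [simp]:
  "fst (ball_map f p) = f (fst p)" "snd (ball_map f p) = snd p"
  by (simp_all add: ball_map_def split_beta)

text \<open>Arrows store the restriction of a map to the points of its source; this carries
  continuity from the map over to the restriction.\<close>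

lemma lipschitz1_continuous_cong:
  assumes "\<And>x. x \<in> points X \<Longrightarrow> f x = g x" and "lipschitz1_continuous X Y f"
  shows "lipschitz1_continuous X Y g"
proof -
  have "ball_map f p = ball_map g p" if "p \<in> balls X" for p
    using that assms(1) by (simp add: ball_map_def balls_iff split_beta)
  with assms show ?thesis
    unfolding lipschitz1_continuous_def
    by (metis scott_continuous_cong Pi_cong)
qed

lemma lipschitz1_continuous_id: "lipschitz1_continuous X X (\<lambda>x. x)"
proof -
  have eq: "ball_map (\<lambda>x. x) = id" by (auto simp: ball_map_def)
  show ?thesis unfolding lipschitz1_continuous_def eq by (simp add: scott_continuous_id)
qed

lemma lipschitz1_continuous_comp:
  assumes "lipschitz1_continuous X Y f" "lipschitz1_continuous Y Z g"
  shows "lipschitz1_continuous X Z (g \<circ> f)"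
proof -
  have "ball_map (g \<circ> f) = ball_map g \<circ> ball_map f" by (auto simp: ball_map_def)
  with assms show ?thesis
    by (auto simp: lipschitz1_continuous_def Pi_iff intro: scott_continuous_comp)
qed

text \<open>Monotonicity of \<open>ball_map f\<close> is applied to balls of radius 0, where the
  ball order means distance at most 0.\<close>

lemma lipschitz1_continuous_dist_0:
  assumes "lipschitz1_continuous X Y f" "x \<in> points X" "y \<in> points X" "qdist X x y = 0"
  shows "qdist Y (f x) (f y) \<le> 0"
proof -
  have "ball_le X (x, 0) (y, 0)" "(x, 0) \<in> balls X" "(y, 0) \<in> balls X"
    using assms by (auto simp: ball_le_iff balls_iff)
  then have "ball_le Y (ball_map f (x, 0)) (ball_map f (y, 0))"
    using assms(1) unfolding lipschitz1_continuous_def scott_continuous_def by blast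
  then show ?thesis by (simp add: ball_le_iff zero_ereal_def)
qed

lemma ball_continuous_flatten: "ball_continuous (B_obj X) X flatten"
  unfolding scott_continuous_def using flatten_in ball_sup_flatten
  by (auto simp: ball_le_B_obj)

text \<open>\<open>ball_map f\<close> keeps radii, so the condition on outer radii in
  \<open>ball_sup_B_objI\<close> is \<open>ball_sup_radius\<close> for \<open>X\<close>; the
  flattened part is the assumption \<open>cont\<close>.\<close>

lemma lipschitz1_continuous_B_objI:
  assumes X: "standard_qms X" and f: "f \<in> points X \<rightarrow> points (B_obj Y)"
    and cont: "ball_continuous X Y (flatten \<circ> ball_map f)"
  shows "lipschitz1_continuous X (B_obj Y) f"
proof -
  have qm: "quasi_metric_space X" using X by (simp add: standard_qms_def)
  have maps: "ball_map f \<in> balls X \<rightarrow> balls (B_obj Y)" using f by (auto simp: balls_iff)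
  have mono: "ball_le (B_obj Y) (ball_map f p) (ball_map f q)"
    if "p \<in> balls X" "q \<in> balls X" "ball_le X p q" for p q
    using that cont ball_le_radius[OF qm that] by (simp add: ball_le_B_obj scott_continuous_def)
  have "ball_sup (B_obj Y) (ball_map f ` D) (ball_map f b)"
    if D: "ball_directed X D" and b: "ball_sup X D b" for D b
  proof (rule ball_sup_B_objI)
    show "ball_directed (B_obj Y) (ball_map f ` D)"
      using D maps mono by (rule directed_in_image)
    show "ball_map f b \<in> balls (B_obj Y)" using maps b by (auto simp: is_sup_in_def)
    have "ball_sup Y ((flatten \<circ> ball_map f) ` D) ((flatten \<circ> ball_map f) b)"
      using cont D b unfolding scott_continuous_def by blast
    then show "ball_sup Y (flatten ` ball_map f ` D) (flatten (ball_map f b))"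
      by (simp add: image_comp)
    show "snd (ball_map f b) = Inf (snd ` ball_map f ` D)"
      using ball_sup_radius[OF X D b] by (simp add: image_image)
  qed
  with f maps mono show ?thesis by (auto simp: lipschitz1_continuous_def scott_continuous_def)
qed

text \<open>The composite to be checked is the identity, which is the law
  \<open>mult_unit_right\<close> on the level of formal balls.\<close>

lemma lipschitz1_continuous_unit:
  assumes "standard_qms X"
  shows "lipschitz1_continuous X (B_obj X) (\<lambda>x. FBall (x, 0))"
proof (rule lipschitz1_continuous_B_objI[OF assms])
  have eq: "flatten \<circ> ball_map (\<lambda>x. FBall (x, 0)) = id"
    by (auto simp: ball_map_def)
  show "ball_continuous X X (flatten \<circ> ball_map (\<lambda>x. FBall (x, 0)))"
    unfolding eq by (rule scott_continuous_id)
qed (auto simp: points_B_obj balls_iff)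

text \<open>Naturality of flattening rewrites the composite into two factors known to be
  Scott-continuous.\<close>

lemma lipschitz1_continuous_ball_map:
  assumes X: "standard_qms X" and f: "lipschitz1_continuous X Y f"
  shows "lipschitz1_continuous (B_obj X) (B_obj Y) (\<lambda>p. FBall (ball_map f (unFBall p)))"
proof (rule lipschitz1_continuous_B_objI[OF standard_qms_B_obj[OF X]])
  have eq: "flatten \<circ> ball_map (\<lambda>p. FBall (ball_map f (unFBall p))) = ball_map f \<circ> flatten"
    by (rule ext) (simp add: flatten_def ball_map_def split_beta)
  show "ball_continuous (B_obj X) Y (flatten \<circ> ball_map (\<lambda>p. FBall (ball_map f (unFBall p))))"
    unfolding eq using f
    by (intro scott_continuous_comp[OF ball_continuous_flatten])
      (simp add: lipschitz1_continuous_def)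
  show "(\<lambda>p. FBall (ball_map f (unFBall p))) \<in> points (B_obj X) \<rightarrow> points (B_obj Y)"
    using f by (auto simp: lipschitz1_continuous_def ball_map_def elim!: points_B_objE)
qed

text \<open>Associativity of the multiplication turns the composite into two successive flattenings,
  one for each level of balls.\<close>

lemma lipschitz1_continuous_mult:
  assumes X: "standard_qms X"
  shows "lipschitz1_continuous (B_obj (B_obj X)) (B_obj X) (\<lambda>p. FBall (flatten (unFBall p)))"
proof (rule lipschitz1_continuous_B_objI[OF standard_qms_B_obj[OF standard_qms_B_obj[OF X]]])
  have eq: "flatten \<circ> ball_map (\<lambda>p. FBall (flatten (unFBall p))) = flatten \<circ> flatten"
    by (rule ext) (simp add: flatten_def ball_map_def split_beta)
  show "ball_continuous (B_obj (B_obj X)) X (flatten \<circ> ball_map (\<lambda>p. FBall (flatten (unFBall p))))"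
    unfolding eq
    by (rule scott_continuous_comp[OF ball_continuous_flatten ball_continuous_flatten])
  show "(\<lambda>p. FBall (flatten (unFBall p))) \<in> points (B_obj (B_obj X)) \<rightarrow> points (B_obj X)"
    using flatten_in[of X] by (auto simp: points_B_obj[of "B_obj X"] points_B_obj[of X])
qed

section \<open>Left KZ-monads from the first condition\<close>

context poset_enriched_category
begin

lemma Comp_monoL:
  assumes "f \<in> hom C X Y" "g \<in> hom C Y Z" "g' \<in> hom C Y Z" "g \<sqsubseteq> g'"
  shows "g \<cdot> f \<sqsubseteq> g' \<cdot> f"
  using assms by (blast intro: Comp_mono Leq_refl)

lemma Comp_monoR:
  assumes "f \<in> hom C X Y" "f' \<in> hom C X Y" "g \<in> hom C Y Z" "f \<sqsubseteq> f'"
  shows "g \<cdot> f \<sqsubseteq> g \<cdot> f'"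
  using assms by (blast intro: Comp_mono Leq_refl)

lemma hom_Obj:
  assumes "f \<in> hom C X Y"
  shows "X \<in> Obj C" "Y \<in> Obj C"
  using assms Dom_in Cod_in by (auto simp: hom_def)

text \<open>Counit: \<open>h f g k \<sqsubseteq> h k \<sqsubseteq> id\<close>. Unit:
  \<open>id \<sqsubseteq> g f \<sqsubseteq> g k h f\<close>.\<close>

lemma adjoint_comp:
  assumes fg: "adjoint C X Y f g" and hk: "adjoint C Y Z h k"
  shows "adjoint C X Z (h \<cdot> f) (g \<cdot> k)"
proof -
  have f: "f \<in> hom C X Y" and g: "g \<in> hom C Y X" and h: "h \<in> hom C Y Z" and k: "k \<in> hom C Z Y"
    and le: "f \<cdot> g \<sqsubseteq> Ide C Y" "Ide C X \<sqsubseteq> g \<cdot> f" "h \<cdot> k \<sqsubseteq> Ide C Z" "Ide C Y \<sqsubseteq> k \<cdot> h"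
    using fg hk by (auto simp: adjoint_def)
  note objs = hom_Obj[OF f] hom_Obj[OF h]
  have fgY: "f \<cdot> g \<in> hom C Y Y" and khY: "k \<cdot> h \<in> hom C Y Y"
    and gk: "g \<cdot> k \<in> hom C Z X" and hf: "h \<cdot> f \<in> hom C X Z"
    using f g h k Comp_in by blast+
  have "(h \<cdot> f) \<cdot> (g \<cdot> k) = h \<cdot> ((f \<cdot> g) \<cdot> k)"
    using Comp_assoc[OF gk f h] Comp_assoc[OF k g f] by simp
  moreover have "h \<cdot> ((f \<cdot> g) \<cdot> k) \<sqsubseteq> h \<cdot> k"
    using Comp_monoL[OF k fgY Ide_in le(1)] Comp_monoR[OF Comp_in[OF k fgY] k h]
      Ide_Comp[OF k] objs by simp
  moreover have "g \<cdot> ((k \<cdot> h) \<cdot> f) = (g \<cdot> k) \<cdot> (h \<cdot> f)"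
    using Comp_assoc[OF hf k g] Comp_assoc[OF f h k] by simp
  moreover have "g \<cdot> f \<sqsubseteq> g \<cdot> ((k \<cdot> h) \<cdot> f)"
    using Comp_monoL[OF f Ide_in khY le(4)] Comp_monoR[OF f Comp_in[OF f khY] g]
      Ide_Comp[OF f] objs by simp
  moreover have "h \<cdot> ((f \<cdot> g) \<cdot> k) \<in> hom C Z Z" "h \<cdot> k \<in> hom C Z Z"
    "g \<cdot> f \<in> hom C X X" "g \<cdot> ((k \<cdot> h) \<cdot> f) \<in> hom C X X"
    using f g h k fgY khY Comp_in by blast+
  ultimately show ?thesis
    unfolding adjoint_def using le(2,3) gk hf objs Ide_in
    by (metis Leq_trans)
qed

text \<open>\<open>f \<sqsubseteq> f g f' \<sqsubseteq> f'\<close>, by the unit of the second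
  adjunction and the counit of the first.\<close>

lemma left_adjoint_le:
  assumes fg: "adjoint C X Y f g" and hg: "adjoint C X Y f' g"
  shows "f \<sqsubseteq> f'"
proof -
  have f: "f \<in> hom C X Y" and f': "f' \<in> hom C X Y" and g: "g \<in> hom C Y X"
    and le: "f \<cdot> g \<sqsubseteq> Ide C Y" "Ide C X \<sqsubseteq> g \<cdot> f'"
    using fg hg by (auto simp: adjoint_def)
  note objs = hom_Obj[OF f]
  have gf': "g \<cdot> f' \<in> hom C X X" and fgY: "f \<cdot> g \<in> hom C Y Y"
    using f f' g Comp_in by blast+
  have "f \<sqsubseteq> f \<cdot> (g \<cdot> f')"
    using Comp_monoR[OF Ide_in gf' f le(2)] Comp_Ide[OF f] objs by simp
  moreover have "f \<cdot> (g \<cdot> f') \<sqsubseteq> f'"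
    using Comp_monoL[OF f' fgY Ide_in le(1)] Ide_Comp[OF f'] Comp_assoc[OF f' g f] objs by simp
  ultimately show ?thesis using Leq_trans[OF f Comp_in[OF gf' f] f'] by blast
qed

lemma left_adjoint_unique:
  assumes "adjoint C X Y f g" "adjoint C X Y f' g"
  shows "f = f'"
  using assms left_adjoint_le[of X Y] Leq_antisym by (meson adjoint_def)

end

text \<open>\<open>KZ1\<close> at \<open>T X\<close>, composed with \<open>F (\<mu> X)\<close>, is
  the unit of the adjunction \<open>KZ3\<close>. The image of \<open>KZ1\<close> under
  \<open>F\<close>, composed with \<open>\<mu> (T X)\<close>, is the counit of \<open>KZ4\<close>.
  The remaining halves are unit laws of the monad.\<close>

lemma left_KZ_monadI:
  fixes C (structure)
  assumes "monad C T F \<eta> \<mu>" and "poset_enriched_category C"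
    and F_mono: "\<And>f g X Y. f \<in> hom C X Y \<Longrightarrow> g \<in> hom C X Y \<Longrightarrow> f \<sqsubseteq> g \<Longrightarrow> F f \<sqsubseteq> F g"
    and KZ1: "\<And>X. X \<in> Obj C \<Longrightarrow> F (\<eta> X) \<sqsubseteq> \<eta> (T X)"
  shows "left_KZ_monad C T F \<eta> \<mu>"
proof -
  interpret monad C T F \<eta> \<mu> by fact
  interpret poset_enriched_category C by fact
  have KZ3: "adjoint C (T (T X)) (T X) (\<mu> X) (\<eta> (T X))" if X: "X \<in> Obj C" for X
  proof -
    note TX = T_in[OF X] and mu = mult_in[OF X]
    have eta: "\<eta> (T X) \<in> hom C (T X) (T (T X))" by (rule unit_in[OF TX])
    have "F (\<mu> X) \<cdot> F (\<eta> (T X)) \<sqsubseteq> F (\<mu> X) \<cdot> \<eta> (T (T X))"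
      by (rule Comp_monoR[OF F_in[OF eta] unit_in[OF T_in[OF TX]] F_in[OF mu] KZ1[OF TX]])
    moreover have "F (\<mu> X) \<cdot> F (\<eta> (T X)) = Ide C (T (T X))"
      using F_Comp[OF eta mu] mult_unit_left[OF X] F_Ide[OF TX] by simp
    moreover have "F (\<mu> X) \<cdot> \<eta> (T (T X)) = \<eta> (T X) \<cdot> \<mu> X" by (rule unit_natural[OF mu])
    ultimately show ?thesis
      using mu eta mult_unit_left[OF X] Leq_refl[OF Ide_in[OF TX]] by (simp add: adjoint_def)
  qed
  have KZ4: "adjoint C (T X) (T (T X)) (F (\<eta> X)) (\<mu> X)" if X: "X \<in> Obj C" for X
  proof -
    note TX = T_in[OF X] and mu = mult_in[OF X] and eta = unit_in[OF X]
    have etaT: "\<eta> (T X) \<in> hom C (T X) (T (T X))" by (rule unit_in[OF TX])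
    have "\<mu> (T X) \<cdot> F (F (\<eta> X)) \<sqsubseteq> \<mu> (T X) \<cdot> F (\<eta> (T X))"
      by (rule Comp_monoR[OF F_in[OF F_in[OF eta]] F_in[OF etaT] mult_in[OF TX]
            F_mono[OF F_in[OF eta] etaT KZ1[OF X]]])
    moreover have "\<mu> (T X) \<cdot> F (\<eta> (T X)) = Ide C (T (T X))" by (rule mult_unit_right[OF TX])
    moreover have "\<mu> (T X) \<cdot> F (F (\<eta> X)) = F (\<eta> X) \<cdot> \<mu> X" by (rule mult_natural[OF eta, symmetric])
    ultimately show ?thesis
      using mu F_in[OF eta] mult_unit_right[OF X] Leq_refl[OF Ide_in[OF TX]]
      by (simp add: adjoint_def)
  qed
  have KZ2: "is_algebra X \<alpha> \<longleftrightarrow> \<alpha> \<cdot> \<eta> X = Ide C X \<and> Ide C (T X) \<sqsubseteq> \<eta> X \<cdot> \<alpha>"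
    if X: "X \<in> Obj C" and a: "\<alpha> \<in> hom C (T X) X" for X \<alpha>
  proof
    note TX = T_in[OF X] and eta = unit_in[OF X]
    have etaT: "\<eta> (T X) \<in> hom C (T X) (T (T X))" by (rule unit_in[OF TX])
    { assume "is_algebra X \<alpha>"
      then have unit: "\<alpha> \<cdot> \<eta> X = Ide C X" by (simp add: is_algebra_def)
      have "F \<alpha> \<cdot> F (\<eta> X) \<sqsubseteq> F \<alpha> \<cdot> \<eta> (T X)"
        by (rule Comp_monoR[OF F_in[OF eta] etaT F_in[OF a] KZ1[OF X]])
      then have "Ide C (T X) \<sqsubseteq> \<eta> X \<cdot> \<alpha>"
        using F_Comp[OF eta a] unit F_Ide[OF X] unit_natural[OF a] by simp
      with unit show "\<alpha> \<cdot> \<eta> X = Ide C X \<and> Ide C (T X) \<sqsubseteq> \<eta> X \<cdot> \<alpha>" by simp }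
    assume *: "\<alpha> \<cdot> \<eta> X = Ide C X \<and> Ide C (T X) \<sqsubseteq> \<eta> X \<cdot> \<alpha>"
    \<comment> \<open>The two conditions make \<open>\<alpha>\<close> left adjoint to
      \<open>\<eta> X\<close>, with an identity as counit. The monotone functor \<open>F\<close>
      preserves this adjunction.\<close>
    have adj: "adjoint C (T X) X \<alpha> (\<eta> X)"
      using * a eta Leq_refl[OF Ide_in[OF X]] by (simp add: adjoint_def)
    have "F (Ide C (T X)) \<sqsubseteq> F (\<eta> X \<cdot> \<alpha>)"
      using * by (intro F_mono[OF Ide_in[OF TX] Comp_in[OF a eta]]) simp
    then have "adjoint C (T (T X)) (T X) (F \<alpha>) (F (\<eta> X))"
      using * F_in[OF a] F_in[OF eta] F_Comp[OF eta a] F_Comp[OF a eta] F_Ide[OF X] F_Ide[OF TX]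
        Leq_refl[OF Ide_in[OF TX]] by (simp add: adjoint_def)
    then have "adjoint C (T (T X)) X (\<alpha> \<cdot> F \<alpha>) (F (\<eta> X) \<cdot> \<eta> X)"
      using adj by (rule adjoint_comp)
    \<comment> \<open>Naturality of the unit at the arrow \<open>\<eta> X\<close> identifies
      \<open>\<eta> (T X) \<cdot> \<eta> X\<close> with
      \<open>F (\<eta> X) \<cdot> \<eta> X\<close>, so both sides of the algebra law are left
      adjoint to the same arrow.\<close>
    moreover have "adjoint C (T (T X)) X (\<alpha> \<cdot> \<mu> X) (F (\<eta> X) \<cdot> \<eta> X)"
      using adjoint_comp[OF KZ3[OF X] adj] unit_natural[OF eta] by simp
    ultimately have "\<alpha> \<cdot> F \<alpha> = \<alpha> \<cdot> \<mu> X" by (rule left_adjoint_unique)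
    with a * show "is_algebra X \<alpha>" by (simp add: is_algebra_def)
  qed
  show ?thesis
    by unfold_locales (fact F_mono KZ1 KZ2 KZ3 KZ4)+
qed

section \<open>The formal ball monad\<close>

lemma hom_SQMet_iff:
  "f \<in> hom SQMet X Y \<longleftrightarrow> standard_qms X \<and> standard_qms Y \<and> source f = X \<and> target f = Y \<and>
     fn f \<in> extensional (points X) \<and> lipschitz1_continuous X Y (fn f)"
  by (auto simp: hom_def SQMet_def)

lemma SQMet_simps:
  "X \<in> Obj SQMet \<longleftrightarrow> standard_qms X" "Dom SQMet = source" "Cod SQMet = target"
  "Ide SQMet X = mk_arrow X (\<lambda>x. x) X"
  "Comp SQMet g f = mk_arrow (source f) (fn g \<circ> fn f) (target g)"
  by (auto simp: SQMet_def)

lemma Leq_SQMet_iff: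
  assumes "f \<in> hom SQMet X Y" "g \<in> hom SQMet X Y"
  shows "Leq SQMet f g \<longleftrightarrow> (\<forall>x\<in>points X. qdist Y (fn f x) (fn g x) = 0)"
  using assms by (auto simp: SQMet_def hom_def)

lemma fn_mk_arrow [simp]: "x \<in> points X \<Longrightarrow> fn (mk_arrow X f Y) x = f x"
  and source_mk_arrow [simp]: "source (mk_arrow X f Y) = X"
  and target_mk_arrow [simp]: "target (mk_arrow X f Y) = Y"
  by (simp_all add: mk_arrow_def)

lemma mk_arrow_in_hom:
  assumes "standard_qms X" "standard_qms Y" "lipschitz1_continuous X Y f"
  shows "mk_arrow X f Y \<in> hom SQMet X Y"
  using assms by (auto simp: hom_SQMet_iff mk_arrow_def elim!: lipschitz1_continuous_cong[rotated])

text \<open>Both maps are \<open>undefined\<close> outside \<open>points X\<close>. All categorical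
  laws below are thereby reduced to calculations at points.\<close>

lemma arrow_eqI:
  assumes "f \<in> hom SQMet X Y" "g \<in> hom SQMet X Y" "\<And>x. x \<in> points X \<Longrightarrow> fn f x = fn g x"
  shows "f = g"
proof (rule qarrow.expand, intro conjI)
  show "fn f = fn g"
    using assms by (intro extensionalityI[of _ "points X"]) (auto simp: hom_SQMet_iff)
qed (use assms in \<open>auto simp: hom_SQMet_iff\<close>)

lemma fn_in_points:
  assumes "f \<in> hom SQMet X Y" "x \<in> points X"
  shows "fn f x \<in> points Y"
  using assms by (auto simp: hom_SQMet_iff lipschitz1_continuous_def)

lemma Ide_SQMet_in_hom: "standard_qms X \<Longrightarrow> Ide SQMet X \<in> hom SQMet X X"
  by (simp add: SQMet_simps mk_arrow_in_hom lipschitz1_continuous_id)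

lemma Comp_SQMet_in_hom:
  assumes "f \<in> hom SQMet X Y" "g \<in> hom SQMet Y Z"
  shows "Comp SQMet g f \<in> hom SQMet X Z"
  using assms
  by (auto simp: SQMet_simps hom_SQMet_iff[of f] hom_SQMet_iff[of g]
      intro!: mk_arrow_in_hom lipschitz1_continuous_comp)

lemma fn_Ide_SQMet [simp]: "x \<in> points X \<Longrightarrow> fn (Ide SQMet X) x = x"
  by (simp add: SQMet_simps)

lemma fn_Comp_SQMet:
  assumes "f \<in> hom SQMet X Y" "x \<in> points X"
  shows "fn (Comp SQMet g f) x = fn g (fn f x)"
  using assms by (auto simp: SQMet_simps hom_SQMet_iff)

lemma category_SQMet: "category SQMet"
proof
  fix f assume "f \<in> Arr SQMet"
  then show "Dom SQMet f \<in> Obj SQMet" "Cod SQMet f \<in> Obj SQMet" by (auto simp: SQMet_def)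
next
  fix X assume "X \<in> Obj SQMet"
  then show "Ide SQMet X \<in> hom SQMet X X" by (simp add: SQMet_simps(1) Ide_SQMet_in_hom)
next
  fix f g X Y Z assume "f \<in> hom SQMet X Y" "g \<in> hom SQMet Y Z"
  then show "Comp SQMet g f \<in> hom SQMet X Z" by (rule Comp_SQMet_in_hom)
next
  fix f X Y assume f: "f \<in> hom SQMet X Y"
  then have XY: "Ide SQMet X \<in> hom SQMet X X" "Ide SQMet Y \<in> hom SQMet Y Y"
    by (auto simp: hom_SQMet_iff[of f] Ide_SQMet_in_hom)
  show "Comp SQMet f (Ide SQMet X) = f"
    by (rule arrow_eqI[OF Comp_SQMet_in_hom[OF XY(1) f] f]) (simp add: fn_Comp_SQMet[OF XY(1)])
  show "Comp SQMet (Ide SQMet Y) f = f"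
    by (rule arrow_eqI[OF Comp_SQMet_in_hom[OF f XY(2)] f])
      (simp add: fn_Comp_SQMet[OF f] fn_in_points[OF f])
next
  fix f g h W X Y Z
  assume f: "f \<in> hom SQMet W X" and g: "g \<in> hom SQMet X Y" and h: "h \<in> hom SQMet Y Z"
  note gf = Comp_SQMet_in_hom[OF f g] and hg = Comp_SQMet_in_hom[OF g h]
  show "Comp SQMet (Comp SQMet h g) f = Comp SQMet h (Comp SQMet g f)"
    by (rule arrow_eqI[OF Comp_SQMet_in_hom[OF f hg] Comp_SQMet_in_hom[OF gf h]])
      (simp add: fn_Comp_SQMet[OF f] fn_Comp_SQMet[OF gf] fn_Comp_SQMet[OF g] fn_in_points[OF f])
qed

text \<open>Transitivity of the ball order at radius 0. The premises are inequalities so that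
  \<open>lipschitz1_continuous_dist_0\<close> can supply them.\<close>

lemma qdist_0_trans:
  assumes qm: "quasi_metric_space X" and pts: "x \<in> points X" "y \<in> points X" "z \<in> points X"
    and "qdist X x y \<le> 0" "qdist X y z \<le> 0"
  shows "qdist X x z = 0"
proof -
  have "ball_le X (x, 0) (z, 0)"
    by (rule ball_le_trans[OF qm, of _ "(y, 0)"])
      (use assms in \<open>auto simp: ball_le_iff balls_iff zero_ereal_def[symmetric]\<close>)
  then have "qdist X x z \<le> 0" by (simp add: ball_le_iff zero_ereal_def)
  moreover have "0 \<le> qdist X x z" using qm pts by (simp add: quasi_metric_space_def)
  ultimately show ?thesis by (rule antisym)
qed

lemma poset_enriched_category_SQMet: "poset_enriched_category SQMet"
proof (intro poset_enriched_category.intro category_SQMet poset_enriched_category_axioms.intro)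
  fix f X Y assume f: "f \<in> hom SQMet X Y"
  then show "Leq SQMet f f"
    using fn_in_points[OF f]
    by (auto simp: Leq_SQMet_iff[OF f f] hom_SQMet_iff standard_qms_def quasi_metric_space_def)
next
  fix f g h X Y assume f: "f \<in> hom SQMet X Y" and g: "g \<in> hom SQMet X Y"
    and h: "h \<in> hom SQMet X Y" and "Leq SQMet f g" "Leq SQMet g h"
  moreover have "quasi_metric_space Y" using f by (auto simp: hom_SQMet_iff standard_qms_def)
  ultimately show "Leq SQMet f h"
    using fn_in_points[OF f] fn_in_points[OF g] fn_in_points[OF h]
    by (simp add: Leq_SQMet_iff[of _ X Y]) (metis qdist_0_trans order_refl)
next
  fix f g X Y assume f: "f \<in> hom SQMet X Y" and g: "g \<in> hom SQMet X Y"
    and "Leq SQMet f g" "Leq SQMet g f"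
  moreover have "quasi_metric_space Y" using f by (auto simp: hom_SQMet_iff standard_qms_def)
  ultimately show "f = g"
    using fn_in_points[OF f] fn_in_points[OF g]
    by (intro arrow_eqI[OF f g]) (auto simp: Leq_SQMet_iff[of _ X Y] quasi_metric_space_def)
next
  fix f f' g g' X Y Z assume f: "f \<in> hom SQMet X Y" and f': "f' \<in> hom SQMet X Y"
    and g: "g \<in> hom SQMet Y Z" and g': "g' \<in> hom SQMet Y Z"
    and le: "Leq SQMet f f'" "Leq SQMet g g'"
  \<comment> \<open>The intermediate point is \<open>fn g (fn f' x)\<close>: continuity of
    \<open>g\<close> gives the first comparison, \<open>g \<sqsubseteq> g'\<close> the
    second.\<close>
  have "qdist Z (fn g (fn f x)) (fn g' (fn f' x)) = 0" if x: "x \<in> points X" for x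
  proof (rule qdist_0_trans)
    note fx = fn_in_points[OF f x] and fx' = fn_in_points[OF f' x]
    show "quasi_metric_space Z" using g by (auto simp: hom_SQMet_iff standard_qms_def)
    show "fn g (fn f x) \<in> points Z" "fn g (fn f' x) \<in> points Z" "fn g' (fn f' x) \<in> points Z"
      using fn_in_points[OF g] fn_in_points[OF g'] fx fx' by blast+
    show "qdist Z (fn g (fn f x)) (fn g (fn f' x)) \<le> 0"
      using le(1) x g fx fx'
      by (intro lipschitz1_continuous_dist_0) (auto simp: Leq_SQMet_iff[OF f f'] hom_SQMet_iff)
    show "qdist Z (fn g (fn f' x)) (fn g' (fn f' x)) \<le> 0"
      using le(2) fx' by (simp add: Leq_SQMet_iff[OF g g'])
  qed
  then show "Leq SQMet (Comp SQMet g f) (Comp SQMet g' f')"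
    by (simp add: Leq_SQMet_iff[OF Comp_SQMet_in_hom[OF f g] Comp_SQMet_in_hom[OF f' g']]
        fn_Comp_SQMet[OF f] fn_Comp_SQMet[OF f'])
qed

section \<open>The functor, unit and multiplication, and the monad laws\<close>

lemma B_arr_in_hom:
  assumes "f \<in> hom SQMet X Y"
  shows "B_arr f \<in> hom SQMet (B_obj X) (B_obj Y)"
  using assms
  by (auto simp: B_arr_def hom_SQMet_iff[of f]
      intro!: mk_arrow_in_hom standard_qms_B_obj lipschitz1_continuous_ball_map)

lemma B_unit_in_hom: "standard_qms X \<Longrightarrow> B_unit X \<in> hom SQMet X (B_obj X)"
  by (simp add: B_unit_def mk_arrow_in_hom standard_qms_B_obj lipschitz1_continuous_unit)

lemma B_mult_eq:
  "B_mult X = mk_arrow (B_obj (B_obj X)) (\<lambda>p. FBall (flatten (unFBall p))) (B_obj X)"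
  by (simp add: B_mult_def flatten_def split_beta)

lemma B_mult_in_hom: "standard_qms X \<Longrightarrow> B_mult X \<in> hom SQMet (B_obj (B_obj X)) (B_obj X)"
  by (simp add: B_mult_eq mk_arrow_in_hom standard_qms_B_obj lipschitz1_continuous_mult)

lemma fn_B_arr:
  assumes "f \<in> hom SQMet X Y" "p \<in> points (B_obj X)"
  shows "fn (B_arr f) p = FBall (ball_map (fn f) (unFBall p))"
  using assms by (simp add: B_arr_def hom_SQMet_iff)

lemma fn_B_unit: "x \<in> points X \<Longrightarrow> fn (B_unit X) x = FBall (x, 0)"
  by (simp add: B_unit_def)

lemma fn_B_mult:
  "p \<in> points (B_obj (B_obj X)) \<Longrightarrow> fn (B_mult X) p = FBall (flatten (unFBall p))"
  by (simp add: B_mult_eq)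

lemma ball_map_Pair [simp]: "ball_map f (x, r) = (f x, r)"
  by (simp add: ball_map_def)

text \<open>Each law is checked at points, with \<open>points_B_objE\<close> opening the nested
  balls; on radii the laws come down to addition being associative with neutral element 0.\<close>

lemma monad_SQMet: "monad SQMet B_obj B_arr B_unit B_mult"
proof (intro monad.intro endofunctor.intro category_SQMet endofunctor_axioms.intro
    monad_axioms.intro)
  fix X :: "'a universe qspace" assume "X \<in> Obj SQMet"
  then have X: "standard_qms X" by (simp add: SQMet_simps)
  note BX = standard_qms_B_obj[OF X]
  note ide = Ide_SQMet_in_hom[OF X] and Bide = Ide_SQMet_in_hom[OF BX]
  note unit = B_unit_in_hom[OF X] and mult = B_mult_in_hom[OF X]
  note unitB = B_unit_in_hom[OF BX] and multB = B_mult_in_hom[OF BX]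
  note Bunit = B_arr_in_hom[OF unit] and Bmult = B_arr_in_hom[OF mult]
  show "B_obj X \<in> Obj SQMet" using BX by (simp add: SQMet_simps)
  show "B_unit X \<in> hom SQMet X (B_obj X)" by (rule unit)
  show "B_mult X \<in> hom SQMet (B_obj (B_obj X)) (B_obj X)" by (rule mult)
  show "B_arr (Ide SQMet X) = Ide SQMet (B_obj X)"
    by (rule arrow_eqI[OF B_arr_in_hom[OF ide] Bide])
      (auto elim!: points_B_objE simp: fn_B_arr[OF ide])
  show "Comp SQMet (B_mult X) (B_arr (B_mult X)) = Comp SQMet (B_mult X) (B_mult (B_obj X))"
    by (rule arrow_eqI[OF Comp_SQMet_in_hom[OF Bmult mult] Comp_SQMet_in_hom[OF multB mult]])
      (auto elim!: points_B_objE
        simp: fn_B_mult fn_B_arr[OF mult] fn_Comp_SQMet[OF Bmult] fn_Comp_SQMet[OF multB])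
  show "Comp SQMet (B_mult X) (B_unit (B_obj X)) = Ide SQMet (B_obj X)"
    by (rule arrow_eqI[OF Comp_SQMet_in_hom[OF unitB mult] Bide])
      (auto elim!: points_B_objE simp: fn_B_mult fn_B_unit fn_Comp_SQMet[OF unitB])
  show "Comp SQMet (B_mult X) (B_arr (B_unit X)) = Ide SQMet (B_obj X)"
    by (rule arrow_eqI[OF Comp_SQMet_in_hom[OF Bunit mult] Bide])
      (auto elim!: points_B_objE
        simp: fn_B_mult fn_B_unit fn_B_arr[OF unit] fn_Comp_SQMet[OF Bunit])
next
  fix f :: "'a universe qarrow" and X Y assume f: "f \<in> hom SQMet X Y"
  then have X: "standard_qms X" and Y: "standard_qms Y" by (auto simp: hom_SQMet_iff)
  note Bf = B_arr_in_hom[OF f] and fp = fn_in_points[OF f]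
  note BBf = B_arr_in_hom[OF Bf] and unit = B_unit_in_hom[OF X] and mult = B_mult_in_hom[OF X]
  show "B_arr f \<in> hom SQMet (B_obj X) (B_obj Y)" by (rule Bf)
  show "Comp SQMet (B_arr f) (B_unit X) = Comp SQMet (B_unit Y) f"
    by (rule arrow_eqI[OF Comp_SQMet_in_hom[OF unit Bf] Comp_SQMet_in_hom[OF f B_unit_in_hom[OF Y]]])
      (simp add: fn_B_unit fn_B_arr[OF f] fn_Comp_SQMet[OF f] fn_Comp_SQMet[OF unit] fp)
  show "Comp SQMet (B_arr f) (B_mult X) = Comp SQMet (B_mult Y) (B_arr (B_arr f))"
    by (rule arrow_eqI[OF Comp_SQMet_in_hom[OF mult Bf] Comp_SQMet_in_hom[OF BBf B_mult_in_hom[OF Y]]])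
      (auto elim!: points_B_objE simp: fn_B_mult fn_B_arr[OF f] fn_B_arr[OF Bf]
        fn_Comp_SQMet[OF BBf] fn_Comp_SQMet[OF mult] fp)
  fix g :: "'a universe qarrow" and Z assume g: "g \<in> hom SQMet Y Z"
  note gf = Comp_SQMet_in_hom[OF f g]
  show "B_arr (Comp SQMet g f) = Comp SQMet (B_arr g) (B_arr f)"
    by (rule arrow_eqI[OF B_arr_in_hom[OF gf] Comp_SQMet_in_hom[OF Bf B_arr_in_hom[OF g]]])
      (auto elim!: points_B_objE simp: fn_B_arr[OF f] fn_B_arr[OF g] fn_B_arr[OF gf]
        fn_Comp_SQMet[OF f] fn_Comp_SQMet[OF Bf] fp)
qed

theorem proposition3p11:
  shows "left_KZ_monad (SQMet :: ('a universe qspace, 'a universe qarrow) pcat)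
           B_obj B_arr B_unit B_mult"
proof (rule left_KZ_monadI[OF monad_SQMet poset_enriched_category_SQMet])
  fix f g :: "'a universe qarrow" and X Y
  assume f: "f \<in> hom SQMet X Y" and g: "g \<in> hom SQMet X Y" and "Leq SQMet f g"
  \<comment> \<open>The two image balls have the same radius, so their order only compares the
    centers.\<close>
  then show "Leq SQMet (B_arr f) (B_arr g)"
    by (auto elim!: points_B_objE simp: Leq_SQMet_iff[OF f g]
        Leq_SQMet_iff[OF B_arr_in_hom[OF f] B_arr_in_hom[OF g]]
        fn_B_arr[OF f] fn_B_arr[OF g] qdist_B_obj ball_dist_eq_0_iff ball_le_iff)
next
  fix X :: "'a universe qspace" assume "X \<in> Obj SQMet"
  then have X: "standard_qms X" by (simp add: SQMet_simps)
  then have "qdist X x x = 0" if "x \<in> points X" for x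
    using that by (auto simp: standard_qms_def quasi_metric_space_def)
  \<comment> \<open>The ball \<open>(x, r)\<close> is sent to \<open>((x, 0), r)\<close> on the left
    and to \<open>((x, r), 0)\<close> on the right. Both flatten to \<open>(x, r)\<close>, and the
    outer radius drops from \<open>r\<close> to 0, so \<open>ball_le_B_obj\<close> applies.\<close>
  then show "Leq SQMet (B_arr (B_unit X)) (B_unit (B_obj X))"
    by (auto elim!: points_B_objE simp: fn_B_arr[OF B_unit_in_hom[OF X]] fn_B_unit
        Leq_SQMet_iff[OF B_arr_in_hom[OF B_unit_in_hom[OF X]]
          B_unit_in_hom[OF standard_qms_B_obj[OF X]]]
        qdist_B_obj ball_dist_eq_0_iff ball_le_B_obj ball_le_iff[of X])
qed

end
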